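(* For each fixed integer $m\geq 2$, as $n\to\infty$, $$c_{\mathrm{L}}(Q(n,m)) = O\!\left(\frac{(m+1)^n}{n^{3/2}}\right);$$ that is, for every integer $m\ge 2$ there exist a constant $C_m>0$ and an integer $N_m$ (both depending only on $m$) such that for all integers $n\ge N_m$, $c_{\mathrm{L}}(Q(n,m))\le C_m\,(m+1)^n/n^{3/2}$.
   Context: Generalized hypercube: for positive integers $n$ and $m$, $Q(n,m)$ is the graph with vertex set $\{0,1,\ldots,m\}^n$, in which two vertices are adjacent when they differ in exactly one coordinate. Lazy Cops and Robbers: let $G$ be a finite connected graph. The cops first choose their initial vertices (several cops may share a vertex), after which the robber chooses an initial vertex. The cops and the robber then alternate turns, beginning with the cops; all positions are visible to both sides. On a cop turn, either all cops remain stationary or exactly one cop moves along an edge to an adjacent vertex. On a robber turn, the robber either remains stationary or moves along an edge to an adjacent vertex. Capture occurs when a cop occupies the robber's vertex. The lazy cop number $c_{\mathrm{L}}(G)$ is the minimum number of cops that can force capture after finitely many turns. *)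

theory Defs
  imports
    Complex_Main
    "HOL-Library.FuncSet"
    "Graph_Theory.Pair_Digraph"
begin

text \<open>
  Graphs are represented as symmetric digraphs: an edge between \<open>x\<close> and \<open>y\<close> is the pair of arcs
  \<open>(x, y)\<close> and \<open>(y, x)\<close>.
\<close>

definition gen_hypercube :: "nat \<Rightarrow> nat \<Rightarrow> (nat \<Rightarrow> nat) pair_pre_digraph" where
  "gen_hypercube n m =
     \<lparr> pverts = {..<n} \<rightarrow>\<^sub>E {0..m},
       parcs = {(x, y). x \<in> {..<n} \<rightarrow>\<^sub>E {0..m} \<and> y \<in> {..<n} \<rightarrow>\<^sub>E {0..m} \<and>
                        (\<exists>!i. i < n \<and> x i \<noteq> y i)} \<rparr>"

lemma pair_graph_gen_hypercube: "pair_graph (gen_hypercube n m)"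
proof
  have fin: "finite (pverts (gen_hypercube n m))"
    unfolding gen_hypercube_def by (simp add: finite_PiE)
  show "finite (pverts (gen_hypercube n m))" by (rule fin)
  have "parcs (gen_hypercube n m) \<subseteq> pverts (gen_hypercube n m) \<times> pverts (gen_hypercube n m)"
    unfolding gen_hypercube_def by auto
  then show "finite (parcs (gen_hypercube n m))"
    using fin by (meson finite_SigmaI finite_subset)
  have "sym (parcs (gen_hypercube n m))"
  proof (rule symI)
    fix x y assume "(x, y) \<in> parcs (gen_hypercube n m)"
    then show "(y, x) \<in> parcs (gen_hypercube n m)"
      unfolding gen_hypercube_def by (simp add: eq_commute[of "y _" "x _"])
  qed
  then show "symmetric (gen_hypercube n m)"
    unfolding symmetric_def by simp
next
  fix e assume e: "e \<in> parcs (gen_hypercube n m)"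
  obtain x y where xy: "e = (x, y)" by (cases e)
  from e xy have "x \<in> pverts (gen_hypercube n m)" "y \<in> pverts (gen_hypercube n m)"
      "\<exists>i. x i \<noteq> y i"
    unfolding gen_hypercube_def by (simp_all, blast)
  with xy show "fst e \<in> pverts (gen_hypercube n m)" "snd e \<in> pverts (gen_hypercube n m)"
      "fst e \<noteq> snd e"
    by auto
qed

text \<open>
  A cop position is the list of the vertices occupied by the cops, one entry per cop; several
  cops may share a vertex.
\<close>

definition lazy_cop_move :: "'a pair_pre_digraph \<Rightarrow> 'a list \<Rightarrow> 'a list \<Rightarrow> bool" where
  "lazy_cop_move G c c' \<longleftrightarrow>
     c' = c \<or> (\<exists>i < length c. \<exists>v. (c ! i, v) \<in> parcs G \<and> c' = c[i := v])"

definition robber_play :: "'a pair_pre_digraph \<Rightarrow> (nat \<Rightarrow> 'a) \<Rightarrow> bool" where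
  "robber_play G r \<longleftrightarrow>
     r 0 \<in> pverts G \<and> (\<forall>t. r (Suc t) = r t \<or> (r t, r (Suc t)) \<in> parcs G)"

text \<open>
  A cop strategy \<open>\<sigma>\<close> maps the list of all vertices the robber has occupied so far (oldest first)
  to the cop position after the cops' reply; \<open>\<sigma> []\<close> is the initial cop position, chosen before
  the robber is placed.  Thus \<open>cops_at \<sigma> r t\<close> is the cop position after \<open>t\<close> cop turns against a
  robber who starts at \<open>r 0\<close> and is at \<open>r t\<close> after \<open>t\<close> turns of his own.
\<close>

definition cops_at :: "('a list \<Rightarrow> 'a list) \<Rightarrow> (nat \<Rightarrow> 'a) \<Rightarrow> nat \<Rightarrow> 'a list" where
  "cops_at \<sigma> r t = \<sigma> (map r [0..<t])"

text \<open>
  The position \<open>r t\<close> of the robber is compared with the cop position directly before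
  (\<open>cops_at \<sigma> r t\<close>) and directly after (\<open>cops_at \<sigma> r (Suc t)\<close>) the next cop turn, so both a capture
  by a cop and a robber stepping onto a cop are covered.  Plays are continued formally
  after a capture; this is harmless because both sides may remain stationary.
\<close>

definition lazy_cops_win :: "'a pair_pre_digraph \<Rightarrow> nat \<Rightarrow> bool" where
  "lazy_cops_win G k \<longleftrightarrow>
     (\<exists>\<sigma>. length (\<sigma> []) = k \<and> set (\<sigma> []) \<subseteq> pverts G \<and>
       (\<forall>r. robber_play G r \<longrightarrow>
         (\<forall>t. lazy_cop_move G (cops_at \<sigma> r t) (cops_at \<sigma> r (Suc t))) \<and>
         (\<exists>t. r t \<in> set (cops_at \<sigma> r t) \<or> r t \<in> set (cops_at \<sigma> r (Suc t)))))"

definition lazy_cop_number :: "'a pair_pre_digraph \<Rightarrow> nat" where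
  "lazy_cop_number G = (LEAST k. lazy_cops_win G k)"

text \<open>On a finite graph, one cop per vertex always suffices, so the minimum is attained.\<close>

lemma lazy_cops_win_card_verts:
  assumes "finite (pverts G)"
  shows "lazy_cops_win G (card (pverts G))"
proof -
  obtain c where c: "set c = pverts G" "length c = card (pverts G)"
    using finite_distinct_list[OF assms] by (metis distinct_card)
  then show ?thesis
    unfolding lazy_cops_win_def
    by (intro exI[of _ "\<lambda>_. c"])
       (auto simp: cops_at_def lazy_cop_move_def robber_play_def)
qed

end

(*
  Let the weight of a vertex be its number of nonzero entries. A move changes the weight by at most
  one, so a robber below layer k stays there as long as the cops dominate layer k. The cops sweep
  downwards: one half of them dominates layer k while the other half, moving one cop at a time,
  takes up positions dominating layer k - 1; then the halves swap roles. It remains to dominate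
  every layer with O((m+1)^n / n^(3/2)) cops. Replacing each vertex by its support, a coset of a
  Hamming code of length 2^r, with n/2 < 2^r <= n, has a neighbour of every vertex; among the 2^r
  cosets one contains at most a fraction 2^(-r) of the layers k - 1, k, k + 1, and a layer has
  O((m+1)^n / sqrt n) vertices.
*)
theory Submission
  imports Defs
begin

section \<open>Oblivious sweeps\<close>

definition threatens :: "'a pair_pre_digraph \<Rightarrow> 'a list \<Rightarrow> 'a \<Rightarrow> bool" where
  "threatens G c v \<longleftrightarrow> (\<exists>u \<in> set c. u = v \<or> (u, v) \<in> parcs G)"

text \<open>
  The cops follow a fixed plan starting at \<open>c\<close>, whatever the robber does, until he is
  threatened at their turn; \<open>S\<close> contains all positions the robber may have.
\<close>

inductive sweeps :: "'a pair_pre_digraph \<Rightarrow> 'a list \<Rightarrow> 'a set \<Rightarrow> bool" for G where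
  threat: "\<forall>v \<in> S. threatens G c v \<Longrightarrow> sweeps G c S"
| move: "lazy_cop_move G c c' \<Longrightarrow>
    (\<And>v v'. v \<in> S \<Longrightarrow> \<not> threatens G c v \<Longrightarrow> v' = v \<or> (v, v') \<in> parcs G \<Longrightarrow> v' \<in> S') \<Longrightarrow>
    sweeps G c' S' \<Longrightarrow> sweeps G c S"

text \<open>Unrolls a derivation of \<open>sweeps\<close> into one infinite sequence of cop
  positions that works against every robber starting in \<open>S\<close>. Each \<open>move\<close>
  prepends a position and shifts the robber's walk by one turn; a \<open>threat\<close> ends the
  plan, which then simply stays put.\<close>

lemma sweeps_plan:
  assumes "sweeps G c S"
  shows "\<exists>P. P 0 = c \<and> (\<forall>t. lazy_cop_move G (P t) (P (Suc t))) \<and>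
    (\<forall>r. r 0 \<in> S \<longrightarrow> (\<forall>t. r (Suc t) = r t \<or> (r t, r (Suc t)) \<in> parcs G) \<longrightarrow>
      (\<exists>t. threatens G (P t) (r t)))"
  using assms
proof induction
  case (threat S c)
  then show ?case
    by (intro exI[of _ "\<lambda>_. c"]) (auto simp: lazy_cop_move_def)
next
  case (move c c' S S')
  from move.IH obtain P where P: "P 0 = c'" "\<And>t. lazy_cop_move G (P t) (P (Suc t))"
    and hit: "\<And>r. r 0 \<in> S' \<Longrightarrow> (\<forall>t. r (Suc t) = r t \<or> (r t, r (Suc t)) \<in> parcs G) \<Longrightarrow>
      \<exists>t. threatens G (P t) (r t)"
    by blast
  show ?case
  proof (intro exI[of _ "case_nat c P"] conjI allI impI)
    fix t show "lazy_cop_move G (case_nat c P t) (case_nat c P (Suc t))"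
      using move.hyps(1) P by (cases t) auto
  next
    fix r assume r: "r 0 \<in> S" "\<forall>t. r (Suc t) = r t \<or> (r t, r (Suc t)) \<in> parcs G"
    show "\<exists>t. threatens G (case_nat c P t) (r t)"
    proof (cases "threatens G c (r 0)")
      case True
      then show ?thesis by (intro exI[of _ 0]) simp
    next
      case False
      then have "r (Suc 0) \<in> S'"
        using move.hyps(2) r by blast
      from hit[of "r \<circ> Suc"] this r(2) obtain t where "threatens G (P t) (r (Suc t))"
        by auto
      then show ?thesis by (intro exI[of _ "Suc t"]) simp
    qed
  qed simp
qed

lemma threatens_imp_capture:
  assumes "threatens G c v"
  shows "\<exists>c'. lazy_cop_move G c c' \<and> v \<in> set c'"
proof -
  from assms obtain u where u: "u \<in> set c" "u = v \<or> (u, v) \<in> parcs G"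
    unfolding threatens_def by blast
  then obtain i where i: "i < length c" "c ! i = u"
    by (auto simp: in_set_conv_nth)
  show ?thesis
    using u(2)
  proof
    assume "u = v"
    with u(1) show ?thesis
      by (auto simp: lazy_cop_move_def)
  next
    assume "(u, v) \<in> parcs G"
    with i have "lazy_cop_move G c (c[i := v]) \<and> v \<in> set (c[i := v])"
      by (auto simp: lazy_cop_move_def set_update_memI)
    then show ?thesis by blast
  qed
qed

text \<open>The strategy follows the plan up to the first turn at which the robber is threatened,
  captures him there and never moves again.\<close>

lemma sweeps_imp_lazy_cops_win:
  assumes sw: "sweeps G c (pverts G)" and c: "set c \<subseteq> pverts G"
  shows "lazy_cops_win G (length c)"
proof -
  from sweeps_plan[OF sw] obtain P where P: "P 0 = c" "\<And>t. lazy_cop_move G (P t) (P (Suc t))"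
    and hit: "\<And>r. robber_play G r \<Longrightarrow> \<exists>t. threatens G (P t) (r t)"
    unfolding robber_play_def by blast
  define cap where "cap c v = (SOME c'. lazy_cop_move G c c' \<and> v \<in> set c')" for c v
  have cap: "lazy_cop_move G c (cap c v)" "v \<in> set (cap c v)" if "threatens G c v" for c v
    using someI_ex[OF threatens_imp_capture[OF that]] unfolding cap_def by auto
  \<comment> \<open>Whether turn \<open>t\<close> is hot depends only on the history
    \<open>h\<close>. Extending \<open>h\<close> leaves the least hot turn unchanged, so the reply
    is frozen after the capture.\<close>
  define hot where "hot h t \<longleftrightarrow> t < length h \<and> threatens G (P t) (h ! t)" for h t
  define \<sigma> where "\<sigma> h = (if \<exists>t. hot h t then let t = LEAST t. hot h t in cap (P t) (h ! t)
    else P (length h))" for h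
  have sigma_Nil: "\<sigma> [] = c"
    by (simp add: \<sigma>_def hot_def P)
  have "(\<forall>t. lazy_cop_move G (cops_at \<sigma> r t) (cops_at \<sigma> r (Suc t))) \<and>
      (\<exists>t. r t \<in> set (cops_at \<sigma> r t) \<or> r t \<in> set (cops_at \<sigma> r (Suc t)))"
    if r: "robber_play G r" for r
  proof -
    define T where "T = (LEAST t. threatens G (P t) (r t))"
    have T: "threatens G (P T) (r T)"
      unfolding T_def by (rule LeastI_ex) (rule hit[OF r])
    have min: "\<not> threatens G (P t) (r t)" if "t < T" for t
      using not_less_Least that unfolding T_def by blast
    \<comment> \<open>\<open>cops_at \<sigma> r t\<close> sees only
      \<open>r 0, ..., r (t - 1)\<close>. Hence turn \<open>T\<close> still starts from
      \<open>P T\<close>, and the capturing reply appears at index \<open>Suc T\<close>.\<close>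
    have before: "cops_at \<sigma> r t = P t" if "t \<le> T" for t
      using min that by (auto simp: cops_at_def \<sigma>_def hot_def)
    have after: "cops_at \<sigma> r t = cap (P T) (r T)" if "T < t" for t
    proof -
      have hot: "hot (map r [0..<t]) T"
        using T that by (simp add: hot_def)
      have "(LEAST s. hot (map r [0..<t]) s) = T"
      proof (rule Least_equality)
        show "T \<le> s" if "hot (map r [0..<t]) s" for s
          using min[of s] that by (force simp: hot_def not_less[symmetric])
      qed (rule hot)
      with hot that show ?thesis
        unfolding cops_at_def \<sigma>_def by (auto simp: Let_def)
    qed
    have "lazy_cop_move G (cops_at \<sigma> r t) (cops_at \<sigma> r (Suc t))" for t
    proof (cases t T rule: linorder_cases)
      case less
      then show ?thesis by (simp add: before P)
    next
      case equal
      then show ?thesis by (simp add: before after cap[OF T])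
    next
      case greater
      then show ?thesis by (simp add: after lazy_cop_move_def)
    qed
    moreover have "r T \<in> set (cops_at \<sigma> r (Suc T))"
      by (simp add: after cap[OF T])
    ultimately show ?thesis by blast
  qed
  with sigma_Nil c show ?thesis
    unfolding lazy_cops_win_def by blast
qed

section \<open>Relocating some of the cops while the others stand guard\<close>

definition cop_step :: "'a pair_pre_digraph \<Rightarrow> nat set \<Rightarrow> 'a list \<Rightarrow> 'a list \<Rightarrow> bool" where
  "cop_step G J c c' \<longleftrightarrow> (\<exists>i \<in> J. i < length c \<and> (\<exists>v. (c ! i, v) \<in> parcs G \<and> c' = c[i := v]))"

lemma cop_step_imp_lazy_cop_move: "cop_step G J c c' \<Longrightarrow> lazy_cop_move G c c'"
  unfolding cop_step_def lazy_cop_move_def by blast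

lemma cop_steps_invariants:
  assumes "(cop_step G J)\<^sup>*\<^sup>* c c'"
  shows "length c' = length c" and "i \<notin> J \<Longrightarrow> c' ! i = c ! i"
  using assms by (induction, auto simp: cop_step_def nth_list_update)

lemma cop_steps_mono:
  assumes "(cop_step G I)\<^sup>*\<^sup>* c c'" "I \<subseteq> J"
  shows "(cop_step G J)\<^sup>*\<^sup>* c c'"
proof -
  have "cop_step G I \<le> cop_step G J"
    using assms(2) unfolding cop_step_def by blast
  from rtranclp_mono[OF this] assms(1) show ?thesis by blast
qed

lemma single_cop_travels:
  assumes "(c ! i, v) \<in> (parcs G)\<^sup>*" "i < length c"
  shows "(cop_step G {i})\<^sup>*\<^sup>* c (c[i := v])"
  using assms(1)
proof induction
  case base
  then show ?case by simp
next
  case (step y z)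
  have "cop_step G {i} (c[i := y]) (c[i := z])"
    unfolding cop_step_def using step.hyps(2) assms(2) by auto
  with step.IH show ?case by (rule rtranclp.rtrancl_into_rtrancl)
qed

text \<open>The cops are routed one after another along paths of the connected graph. A cop that has
  arrived stays in place, since each later journey moves a different index.\<close>

lemma cops_travel:
  assumes conn: "\<And>x y. x \<in> pverts G \<Longrightarrow> y \<in> pverts G \<Longrightarrow> (x, y) \<in> (parcs G)\<^sup>*"
    and "finite J" "J \<subseteq> {..<length c}" "set c \<subseteq> pverts G" "g ` J \<subseteq> pverts G"
  shows "\<exists>c'. (cop_step G J)\<^sup>*\<^sup>* c c' \<and> set c' \<subseteq> pverts G \<and> (\<forall>i \<in> J. c' ! i = g i)"
  using assms(2-)
proof (induction J)
  case empty
  then show ?case by auto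
next
  case (insert j J)
  then obtain c' where c': "(cop_step G J)\<^sup>*\<^sup>* c c'" "set c' \<subseteq> pverts G" "\<forall>i \<in> J. c' ! i = g i"
    by auto
  have len: "length c' = length c"
    using cop_steps_invariants(1)[OF c'(1)] .
  have j: "j < length c'"
    using insert.prems(1) len by auto
  have "(c' ! j, g j) \<in> (parcs G)\<^sup>*"
    using c'(2) j insert.prems(3) by (intro conn) auto
  from single_cop_travels[OF this j] have "(cop_step G (insert j J))\<^sup>*\<^sup>* c' (c'[j := g j])"
    by (rule cop_steps_mono) simp
  moreover have "(cop_step G (insert j J))\<^sup>*\<^sup>* c c'"
    using c'(1) by (rule cop_steps_mono) auto
  moreover have "set (c'[j := g j]) \<subseteq> pverts G"
    using c'(2) insert.prems(3) set_update_subset_insert[of c' j "g j"] by auto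
  moreover have "\<forall>i \<in> insert j J. c'[j := g j] ! i = g i"
    using c'(3) j insert.hyps(2) by (metis insert_iff nth_list_update_eq nth_list_update_neq)
  ultimately show ?case
    by (meson rtranclp_trans)
qed

text \<open>
  The cops indexed by \<open>I\<close> are the half dominating layer \<open>k\<close>; the induction step moves only the
  others.
\<close>

lemma guarded_layer_sweeps:
  fixes w :: "'a \<Rightarrow> nat"
  assumes arcs: "parcs G \<subseteq> pverts G \<times> pverts G"
    and conn: "\<And>x y. x \<in> pverts G \<Longrightarrow> y \<in> pverts G \<Longrightarrow> (x, y) \<in> (parcs G)\<^sup>*"
    and w: "\<And>x y. (x, y) \<in> parcs G \<Longrightarrow> w y \<le> Suc (w x)"
    and D: "\<And>k. D k \<subseteq> pverts G" "\<And>k. finite (D k)" "\<And>k. card (D k) \<le> d"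
    and dom: "\<And>x. x \<in> pverts G \<Longrightarrow> \<exists>u \<in> D (w x). u = x \<or> (u, x) \<in> parcs G"
    and "length c = 2 * d" "set c \<subseteq> pverts G" "I \<subseteq> {..<2 * d}" "card I \<le> d" "D k \<subseteq> (!) c ` I"
  shows "sweeps G c {v \<in> pverts G. w v \<le> k}"
proof -
  have guard: "threatens G c v"
    if "D (w v) \<subseteq> (!) c ` I" "I \<subseteq> {..<length c}" "v \<in> pverts G" for c I v
    using dom[OF that(3)] that(1,2) unfolding threatens_def by force
  show ?thesis
    using assms(8-)
  proof (induction k arbitrary: c I)
    case 0
    then show ?case
      by (intro sweeps.threat) (auto intro!: guard[of _ c I])
  next
    case (Suc k)
    have "finite I"
      using Suc.prems(3) finite_subset by blast
    \<comment> \<open>The guards use at most \<open>d\<close> of the \<open>2 * d\<close> cops, so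
      at least \<open>d\<close> are free to occupy the next dominating set.\<close>
    then have "card (D k) \<le> card ({..<2 * d} - I)"
      using D(3)[of k] Suc.prems(3,4) by (simp add: card_Diff_subset)
    then obtain J where J: "J \<subseteq> {..<2 * d} - I" "card J = card (D k)" "finite J"
      by (meson finite_Diff finite_lessThan finite_subset obtain_subset_with_card_n)
    then obtain g where g: "bij_betw g J (D k)"
      using D(2) finite_same_card_bij by blast
    then have gJ: "g ` J = D k"
      by (rule bij_betw_imp_surj_on)
    obtain c' where c': "(cop_step G J)\<^sup>*\<^sup>* c c'" "set c' \<subseteq> pverts G" "\<forall>i \<in> J. c' ! i = g i"
      using cops_travel[OF conn J(3), of c g] J(1) Suc.prems(1,2) gJ D(1)[of k] by auto
    have len: "length c' = 2 * d"
      using cop_steps_invariants(1)[OF c'(1)] Suc.prems(1) by simp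
    have D_k: "D k \<subseteq> (!) c' ` J"
      using c'(3) gJ by (auto simp: image_def)
    have win_k: "sweeps G c' {v \<in> pverts G. w v \<le> k}"
      using len c'(2) J(1,2) D(3)[of k] D_k by (intro Suc.IH[of c' J]) auto
    \<comment> \<open>In every position \<open>b\<close> reached on the way the guards
      \<open>I\<close> have not moved, so layer \<open>Suc k\<close> is still dominated.\<close>
    have unthreatened: "w v \<le> k"
      if v: "v \<in> pverts G" "w v \<le> Suc k" "\<not> threatens G b v" and b: "(cop_step G J)\<^sup>*\<^sup>* c b" for b v
    proof -
      have "b ! i = c ! i" if "i \<in> I" for i
        using cop_steps_invariants(2)[OF b] J(1) that by blast
      then have "D (Suc k) \<subseteq> (!) b ` I"
        using Suc.prems(5) by (auto simp: image_def)
      then have "w v \<noteq> Suc k"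
        using guard[of v b I] v(1,3) Suc.prems(1,3) cop_steps_invariants(1)[OF b] by auto
      with v(2) show ?thesis by simp
    qed
    \<comment> \<open>The journey from \<open>c\<close> to \<open>c'\<close> is traversed backwards,
      because \<open>sweeps\<close> is derived from the end of the plan. Before each cop move an
      unthreatened robber has weight at most \<open>k\<close>, so his reply keeps it at most
      \<open>Suc k\<close>.\<close>
    have "sweeps G b {v \<in> pverts G. w v \<le> Suc k}"
      if "(cop_step G J)\<^sup>*\<^sup>* b c'" "(cop_step G J)\<^sup>*\<^sup>* c b" for b
      using that
    proof (induction rule: converse_rtranclp_induct)
      case base
      show ?case
      \<comment> \<open>At \<open>c'\<close> both layers \<open>Suc k\<close> and \<open>k\<close>
        are dominated. The cops pass once: an unthreatened robber is strictly below layer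
        \<open>k\<close> and cannot climb above it in one move, so the old guards may be
        released.\<close>
      proof (rule sweeps.move[OF _ _ win_k])
        show "lazy_cop_move G c' c'"
          by (simp add: lazy_cop_move_def)
      next
        fix v v' assume v: "v \<in> {v \<in> pverts G. w v \<le> Suc k}" "\<not> threatens G c' v"
          "v' = v \<or> (v, v') \<in> parcs G"
        show "v' \<in> {v \<in> pverts G. w v \<le> k}"
        proof -
          have "w v \<le> k"
            using unthreatened c'(1) v by blast
          moreover have "w v \<noteq> k"
            using guard[of v c' J] D_k J(1) len v by auto
          ultimately show ?thesis
            using v arcs w[of v v'] by auto
        qed
      qed
    next
      case (step b b')
      then have b': "sweeps G b' {v \<in> pverts G. w v \<le> Suc k}"
        by (meson rtranclp.rtrancl_into_rtrancl)
      show ?case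
      proof (rule sweeps.move[OF _ _ b'])
        show "lazy_cop_move G b b'"
          using step.hyps(1) by (rule cop_step_imp_lazy_cop_move)
      next
        fix v v' assume v: "v \<in> {v \<in> pverts G. w v \<le> Suc k}" "\<not> threatens G b v"
          "v' = v \<or> (v, v') \<in> parcs G"
        then have "w v \<le> k"
          using unthreatened step.prems by blast
        with v(1,3) arcs w[of v v'] show "v' \<in> {v \<in> pverts G. w v \<le> Suc k}"
          by auto
      qed
    qed
    from this[OF c'(1)] show ?case by simp
  qed
qed

text \<open>The sweep starts by guarding the layer of maximal weight, below or on which the whole
  graph lies.\<close>

lemma lazy_cops_win_of_layer_dominating_sets:
  fixes w :: "'a \<Rightarrow> nat"
  assumes fin: "finite (pverts G)" "pverts G \<noteq> {}"
    and arcs: "parcs G \<subseteq> pverts G \<times> pverts G"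
    and conn: "\<And>x y. x \<in> pverts G \<Longrightarrow> y \<in> pverts G \<Longrightarrow> (x, y) \<in> (parcs G)\<^sup>*"
    and w: "\<And>x y. (x, y) \<in> parcs G \<Longrightarrow> w y \<le> Suc (w x)"
    and D: "\<And>k. D k \<subseteq> pverts G" "\<And>k. card (D k) \<le> d"
    and dom: "\<And>x. x \<in> pverts G \<Longrightarrow> \<exists>u \<in> D (w x). u = x \<or> (u, x) \<in> parcs G"
  shows "lazy_cops_win G (2 * d)"
proof -
  define n where "n = Max (w ` pverts G)"
  have n: "{v \<in> pverts G. w v \<le> n} = pverts G"
    using fin by (auto simp: n_def)
  have finD: "finite (D k)" for k
    using D(1) fin(1) by (rule finite_subset)
  obtain a where a: "a \<in> pverts G"
    using fin(2) by blast
  obtain xs where xs: "set xs = D n" "length xs = card (D n)"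
    using finite_distinct_list[OF finD] by (metis distinct_card)
  \<comment> \<open>The first cops dominate the top layer; the rest are parked at an arbitrary
    vertex until they are needed.\<close>
  define c where "c = xs @ replicate (2 * d - length xs) a"
  have len: "length c = 2 * d"
    using xs(2) D(2)[of n] by (simp add: c_def)
  have c: "set c \<subseteq> pverts G"
    using xs(1) D(1)[of n] a by (auto simp: c_def)
  have "D n \<subseteq> (!) c ` {..<length xs}"
  proof
    fix u assume "u \<in> D n"
    then obtain i where "i < length xs" "u = xs ! i"
      using xs(1) by (metis in_set_conv_nth)
    then show "u \<in> (!) c ` {..<length xs}"
      by (auto simp: c_def nth_append)
  qed
  then have "sweeps G c {v \<in> pverts G. w v \<le> n}"
    using D(2)[of n] xs(2)
    by (intro guarded_layer_sweeps[where D = D and d = d and I = "{..<length xs}",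
          OF arcs conn w D(1) finD D(2) dom len c]) auto
  then show ?thesis
    using sweeps_imp_lazy_cops_win[of G c] c n len by simp
qed

section \<open>Small dominating sets of layers\<close>

definition weight :: "nat \<Rightarrow> (nat \<Rightarrow> nat) \<Rightarrow> nat" where
  "weight n x = card {i. i < n \<and> x i \<noteq> 0}"

lemma pverts_gen_hypercube: "pverts (gen_hypercube n m) = {..<n} \<rightarrow>\<^sub>E {0..m}"
  by (simp add: gen_hypercube_def)

lemma arc_fun_upd:
  assumes "x \<in> pverts (gen_hypercube n m)" "i < n" "a \<le> m" "a \<noteq> x i"
  shows "(x, x(i := a)) \<in> parcs (gen_hypercube n m)" "(x(i := a), x) \<in> parcs (gen_hypercube n m)"
proof -
  have "x(i := a) \<in> {..<n} \<rightarrow>\<^sub>E {0..m}"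
    using assms by (auto simp: pverts_gen_hypercube PiE_iff extensional_def)
  moreover have "x \<in> {..<n} \<rightarrow>\<^sub>E {0..m}"
    using assms(1) by (simp add: pverts_gen_hypercube)
  ultimately show "(x, x(i := a)) \<in> parcs (gen_hypercube n m)"
      "(x(i := a), x) \<in> parcs (gen_hypercube n m)"
    using assms(2,4) by (auto simp: gen_hypercube_def)
qed

lemma gen_hypercube_connected:
  assumes x: "x \<in> pverts (gen_hypercube n m)" and y: "y \<in> pverts (gen_hypercube n m)"
  shows "(x, y) \<in> (parcs (gen_hypercube n m))\<^sup>*"
proof -
  \<comment> \<open>The path overwrites the coordinates of \<open>x\<close> by those of
    \<open>y\<close> from left to right.\<close>
  let ?z = "\<lambda>k i. if i < k then y i else x i"
  have "(x, ?z k) \<in> (parcs (gen_hypercube n m))\<^sup>*" if "k \<le> n" for k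
    using that
  proof (induction k)
    case (Suc k)
    have z: "?z k \<in> pverts (gen_hypercube n m)"
      using x y Suc.prems by (auto simp: pverts_gen_hypercube PiE_iff extensional_def)
    have upd: "?z (Suc k) = (?z k)(k := y k)"
      by auto
    show ?case
    proof (cases "y k = x k")
      case True
      then have "?z (Suc k) = ?z k"
        using upd by auto
      with Suc show ?thesis by simp
    next
      case False
      have "(?z k, ?z (Suc k)) \<in> parcs (gen_hypercube n m)"
        unfolding upd using z False Suc.prems y
        by (intro arc_fun_upd) (auto simp: pverts_gen_hypercube PiE_iff)
      with Suc show ?thesis
        by (meson Suc_leD rtrancl.rtrancl_into_rtrancl)
    qed
  qed simp
  moreover have "?z n = y"
    using x y by (auto simp: pverts_gen_hypercube PiE_iff extensional_def)
  ultimately show ?thesis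
    by (metis order_refl)
qed

lemma weight_arc:
  assumes "(x, y) \<in> parcs (gen_hypercube n m)"
  shows "weight n y \<le> Suc (weight n x)"
proof -
  have "\<exists>!i. i < n \<and> x i \<noteq> y i"
    using assms by (simp add: gen_hypercube_def)
  then obtain i where "\<And>j. j < n \<Longrightarrow> x j \<noteq> y j \<Longrightarrow> j = i"
    by blast
  then have "{j. j < n \<and> y j \<noteq> 0} \<subseteq> insert i {j. j < n \<and> x j \<noteq> 0}"
    by force
  then have "weight n y \<le> card (insert i {j. j < n \<and> x j \<noteq> 0})"
    unfolding weight_def by (intro card_mono) auto
  also have "\<dots> \<le> Suc (weight n x)"
    unfolding weight_def by (simp add: card_insert_if)
  finally show ?thesis .
qed

text \<open>A vertex of the layer is given by its support, a \<open>k\<close>-set, and a value in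
  \<open>{1..m}\<close> at each position of it. An upper bound suffices, so a union bound over the
  supports avoids proving disjointness.\<close>

lemma weight_layer_card:
  "card {x \<in> {..<n} \<rightarrow>\<^sub>E {0..m}. weight n x = k} \<le> (n choose k) * m ^ k"
proof -
  let ?T = "{T. T \<subseteq> {..<n} \<and> card T = k}"
  let ?F = "\<lambda>T. PiE {..<n} (\<lambda>i. if i \<in> T then {1..m} else {0})"
  have finT: "finite ?T"
    by simp
  have cardF: "card (?F T) = m ^ k" if "T \<in> ?T" for T
  proof -
    have "card (?F T) = (\<Prod>i<n. if i \<in> T then m else 1)"
      by (simp add: card_PiE if_distrib cong: if_cong)
    also have "\<dots> = m ^ card ({..<n} \<inter> T)"
      by (simp add: prod.If_cases Int_def)
    finally show ?thesis
      using that by (simp add: Int_absorb1)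
  qed
  have "{x \<in> {..<n} \<rightarrow>\<^sub>E {0..m}. weight n x = k} \<subseteq> (\<Union>T \<in> ?T. ?F T)"
  proof
    fix x assume x: "x \<in> {x \<in> {..<n} \<rightarrow>\<^sub>E {0..m}. weight n x = k}"
    then have "x \<in> ?F {i. i < n \<and> x i \<noteq> 0}"
      by (auto simp: PiE_iff Suc_le_eq)
    moreover have "{i. i < n \<and> x i \<noteq> 0} \<in> ?T"
      using x by (auto simp: weight_def)
    ultimately show "x \<in> (\<Union>T \<in> ?T. ?F T)" by blast
  qed
  then have "card {x \<in> {..<n} \<rightarrow>\<^sub>E {0..m}. weight n x = k} \<le> card (\<Union>T \<in> ?T. ?F T)"
    using finT by (intro card_mono) (auto intro!: finite_PiE)
  also have "\<dots> \<le> (\<Sum>T \<in> ?T. card (?F T))"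
    using finT by (rule card_UN_le)
  also have "\<dots> = (\<Sum>T \<in> ?T. m ^ k)"
    using cardF by (intro sum.cong) auto
  also have "\<dots> = (n choose k) * m ^ k"
    by (simp add: n_subsets)
  finally show ?thesis .
qed

text \<open>
  With \<open>h\<close> a bijection from \<open>{..<2 ^ r}\<close> onto the subsets of \<open>{..<r}\<close>, this is the syndrome of
  the binary Hamming code (with an additional zero column, where \<open>h i = {}\<close>), applied to the support of \<open>x\<close>.
\<close>

definition syndrome :: "(nat \<Rightarrow> nat set) \<Rightarrow> nat \<Rightarrow> (nat \<Rightarrow> nat) \<Rightarrow> nat set" where
  "syndrome h r x = {b. b < r \<and> odd (card {i. i < 2 ^ r \<and> x i \<noteq> 0 \<and> b \<in> h i})}"

text \<open>Switching coordinate \<open>i\<close> between zero and nonzero adds \<open>i\<close> to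
  the support or removes it. Either way the syndrome changes by symmetric difference with
  \<open>h i\<close>.\<close>

lemma syndrome_toggle:
  assumes "i < 2 ^ r" "a = 0 \<longleftrightarrow> x i \<noteq> 0"
  shows "b \<in> syndrome h r (x(i := a)) \<longleftrightarrow> b < r \<and> (b \<in> syndrome h r x \<longleftrightarrow> b \<notin> h i)"
proof -
  let ?A = "\<lambda>x. {j. j < 2 ^ r \<and> x j \<noteq> 0 \<and> b \<in> h j}"
  have "odd (card (?A (x(i := a)))) \<longleftrightarrow> (odd (card (?A x)) \<longleftrightarrow> b \<notin> h i)"
  proof (cases "b \<in> h i")
    case False
    then have "?A (x(i := a)) = ?A x"
      by auto
    with False show ?thesis by simp
  next
    case b: True
    show ?thesis
    proof (cases "x i = 0")
      case True
      then have "?A (x(i := a)) = insert i (?A x)" "i \<notin> ?A x"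
        using assms b by auto
      then have "card (?A (x(i := a))) = Suc (card (?A x))"
        by simp
      with b show ?thesis by simp
    next
      case False
      then have "?A x = insert i (?A (x(i := a)))" "i \<notin> ?A (x(i := a))"
        using assms b by auto
      then have "card (?A x) = Suc (card (?A (x(i := a))))"
        using card_insert_disjoint[of "?A (x(i := a))" i] by simp
      with b show ?thesis by simp
    qed
  qed
  then show ?thesis
    by (auto simp: syndrome_def)
qed

text \<open>The symmetric difference of \<open>S\<close> and the syndrome of \<open>x\<close> is
  some column \<open>h i\<close>, and toggling coordinate \<open>i\<close> produces
  \<open>S\<close>. Thanks to the zero column this gives a proper neighbour even when
  \<open>x\<close> already has syndrome \<open>S\<close>.\<close>

lemma syndrome_covering:
  assumes h: "bij_betw h {..<2 ^ r} (Pow {..<r})" and n: "2 ^ r \<le> n" and m: "m \<ge> 1"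
    and S: "S \<subseteq> {..<r}" and x: "x \<in> pverts (gen_hypercube n m)"
  obtains y where "(y, x) \<in> parcs (gen_hypercube n m)" "(x, y) \<in> parcs (gen_hypercube n m)"
    "syndrome h r y = S"
proof -
  let ?D = "{b. b < r \<and> (b \<in> S \<longleftrightarrow> b \<notin> syndrome h r x)}"
  have "?D \<in> h ` {..<2 ^ r}"
    using bij_betw_imp_surj_on[OF h] by auto
  then obtain i where i: "i < 2 ^ r" "h i = ?D"
    by auto
  define a :: nat where "a = (if x i = 0 then 1 else 0)"
  have "syndrome h r (x(i := a)) = S"
    using i S syndrome_toggle[of i r a x] by (auto simp: a_def)
  moreover have "i < n" "a \<le> m" "a \<noteq> x i"
    using i n m by (auto simp: a_def)
  ultimately show ?thesis
    using arc_fun_upd[OF x] that by metis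
qed

text \<open>Averaging: the fibres over \<open>T\<close> partition \<open>L\<close>, so they cannot
  all exceed the mean size.\<close>

lemma small_fibre:
  assumes "finite L" "finite T" "T \<noteq> {}" "f ` L \<subseteq> T"
  shows "\<exists>s \<in> T. card T * card {x \<in> L. f x = s} \<le> card L"
proof (rule ccontr)
  assume "\<not> ?thesis"
  then have "(\<Sum>s \<in> T. card L) < (\<Sum>s \<in> T. card T * card {x \<in> L. f x = s})"
    using assms by (intro sum_strict_mono) auto
  also have "\<dots> = card T * (\<Sum>s \<in> T. card {x \<in> L. f x = s})"
    by (simp add: sum_distrib_left)
  also have "(\<Sum>s \<in> T. card {x \<in> L. f x = s}) = card L"
    using sum.group[OF assms(1,2,4), of "\<lambda>_. 1"] by (simp only: card_eq_sum)
  finally show False by simp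
qed

text \<open>A neighbour of a vertex in layer \<open>k\<close> lies in one of three consecutive
  layers, so a coset needs to be kept only there. The smallest of the \<open>2 ^ r\<close>
  restricted cosets is taken; the factor 3 counts the layers.\<close>

lemma layer_dominating_set:
  assumes m: "m \<ge> 1" and n: "2 ^ r \<le> n"
    and M: "\<And>k. real ((n choose k) * m ^ k) \<le> M"
  shows "\<exists>D \<subseteq> pverts (gen_hypercube n m). 2 ^ r * real (card D) \<le> 3 * M \<and>
    (\<forall>x \<in> pverts (gen_hypercube n m). weight n x = k \<longrightarrow>
      (\<exists>u \<in> D. (u, x) \<in> parcs (gen_hypercube n m)))"
proof -
  let ?V = "pverts (gen_hypercube n m)"
  obtain h where h: "bij_betw h {..<2 ^ r :: nat} (Pow {..<r})"
    using finite_same_card_bij[of "{..<2 ^ r :: nat}" "Pow {..<r}"] by (auto simp: card_Pow)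
  let ?W = "\<lambda>j. {x \<in> ?V. weight n x = j}"
  \<comment> \<open>The lower bound \<open>k - 1\<close> on the weight is stated with
    \<open>Suc\<close>, which avoids truncated subtraction. For \<open>k = 0\<close> the cover by
    three layers used below still holds, with layer 0 listed twice.\<close>
  define L where "L = {x \<in> ?V. weight n x \<le> Suc k \<and> k \<le> Suc (weight n x)}"
  have finV: "finite ?V"
    by (simp add: pverts_gen_hypercube finite_PiE)
  have W: "real (card (?W j)) \<le> M" for j
    using of_nat_mono[OF weight_layer_card[of n m j]] M[of j] unfolding pverts_gen_hypercube
    by (rule order_trans)
  have "L \<subseteq> ?W (k - 1) \<union> ?W k \<union> ?W (Suc k)"
    by (auto simp: L_def)
  then have "card L \<le> card (?W (k - 1) \<union> ?W k \<union> ?W (Suc k))"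
    using finV by (intro card_mono) auto
  also have "\<dots> \<le> card (?W (k - 1)) + card (?W k) + card (?W (Suc k))"
    by (meson add_mono card_Un_le order_refl order_trans)
  finally have "real (card L) \<le> real (card (?W (k - 1)) + card (?W k) + card (?W (Suc k)))"
    by (rule of_nat_mono)
  then have L: "real (card L) \<le> 3 * M"
    using W[of "k - 1"] W[of k] W[of "Suc k"] by simp
  have "finite L"
    using finV by (simp add: L_def)
  moreover have "syndrome h r ` L \<subseteq> Pow {..<r}"
    by (auto simp: syndrome_def)
  ultimately obtain S where S: "S \<subseteq> {..<r}" "2 ^ r * card {x \<in> L. syndrome h r x = S} \<le> card L"
    using small_fibre[of L "Pow {..<r}" "syndrome h r"] by (auto simp: card_Pow)
  define D where "D = {x \<in> L. syndrome h r x = S}"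
  have "real (2 ^ r * card D) \<le> real (card L)"
    using S(2) unfolding D_def by (rule of_nat_mono)
  then have "2 ^ r * real (card D) \<le> 3 * M"
    using L by simp
  moreover have "\<exists>u \<in> D. (u, x) \<in> parcs (gen_hypercube n m)" if x: "x \<in> ?V" "weight n x = k" for x
  proof -
    obtain y where y: "(y, x) \<in> parcs (gen_hypercube n m)" "(x, y) \<in> parcs (gen_hypercube n m)"
      "syndrome h r y = S"
      using syndrome_covering[OF h n m S(1) x(1)] .
    then have "y \<in> D"
      using weight_arc[OF y(1)] weight_arc[OF y(2)] x(2)
      by (auto simp: D_def L_def gen_hypercube_def)
    with y(1) show ?thesis by blast
  qed
  ultimately show ?thesis
    by (intro exI[of _ D]) (auto simp: D_def L_def)
qed

section \<open>The size of a layer\<close>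

lemma central_binomial_Suc: "(2 * Suc n) choose Suc n = 2 * ((2 * n + 1) choose n)"
  using binomial_symmetric[of n "2 * n + 1"] by simp

text \<open>The square of the estimate \<open>4 ^ n / sqrt (2 * n + 1)\<close>, kept in the
  naturals. The induction uses the ratio \<open>2 * (2 * n + 1) / (n + 1)\<close> of consecutive
  central coefficients.\<close>

lemma central_binomial_upper: "((2 * n) choose n)\<^sup>2 * (2 * n + 1) \<le> (16::nat) ^ n"
proof (induction n)
  case (Suc n)
  define b c d where "b = (2 * n + 1) choose n" and "c = (2 * n) choose n"
    and "d = (2 * Suc n) choose Suc n"
  have IH: "c\<^sup>2 * (2 * n + 1) \<le> 16 ^ n"
    unfolding c_def by (rule Suc.IH)
  have "d = 2 * b"
    unfolding b_def d_def by (rule central_binomial_Suc)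
  moreover have "(n + 1) * b = (2 * n + 1) * c"
    using binomial_absorb_comp[of "2 * n + 1" n] by (simp add: b_def c_def)
  ultimately have "(n + 1) * d = 2 * (2 * n + 1) * c"
    by (metis mult.assoc mult.left_commute)
  then have "((n + 1) * d)\<^sup>2 * (2 * n + 3) = 4 * (2 * n + 1) * (2 * n + 3) * (c\<^sup>2 * (2 * n + 1))"
    by (simp only: power2_eq_square) (simp add: algebra_simps)
  also have "\<dots> \<le> 4 * (2 * n + 1) * (2 * n + 3) * 16 ^ n"
    by (intro mult_left_mono IH) auto
  \<comment> \<open>This is \<open>(2 * n + 1) * (2 * n + 3) \<le> 4 * (n + 1)\<^sup>2\<close>,
    where the two sides differ by 1.\<close>
  also have "\<dots> \<le> (16 * (n + 1)\<^sup>2) * 16 ^ n"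
    by (intro mult_right_mono) (auto simp: power2_eq_square algebra_simps)
  finally have "(n + 1)\<^sup>2 * (d\<^sup>2 * (2 * n + 3)) \<le> (n + 1)\<^sup>2 * 16 ^ Suc n"
    by (simp only: power_mult_distrib power_Suc mult_ac)
  then have "d\<^sup>2 * (2 * n + 3) \<le> 16 ^ Suc n"
    by (subst (asm) mult_le_cancel1) simp
  moreover have "2 * Suc n + 1 = 2 * n + 3"
    by simp
  ultimately show ?case
    unfolding d_def by metis
qed simp

text \<open>The middle coefficient is the largest. For odd \<open>j\<close> it is half of the
  central coefficient of \<open>j + 1\<close>, which reduces this case to the even one.\<close>

lemma binomial_upper: "(j choose i)\<^sup>2 * (j + 1) \<le> (4::nat) ^ j"
proof -
  have le: "(j choose i)\<^sup>2 * (j + 1) \<le> (j choose (j div 2))\<^sup>2 * (j + 1)"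
    by (intro mult_right_mono power_mono binomial_maximum) auto
  show ?thesis
  proof (cases "even j")
    case True
    then obtain n where j: "j = 2 * n" by blast
    have "(4::nat) ^ j = 16 ^ n"
      by (simp add: j power_mult)
    with le central_binomial_upper[of n] show ?thesis
      by (simp add: j)
  next
    case False
    then obtain n where j: "j = 2 * n + 1" by (rule oddE)
    define b where "b = j choose (j div 2)"
    have "(2 * Suc n) choose Suc n = 2 * b"
      unfolding b_def j central_binomial_Suc by simp
    moreover have "16 ^ Suc n = 4 * (4::nat) ^ j"
      by (simp add: j power_mult)
    moreover have "2 * Suc n + 1 = j + 2"
      by (simp add: j)
    ultimately have "(2 * b)\<^sup>2 * (j + 2) \<le> 4 * 4 ^ j"
      using central_binomial_upper[of "Suc n"] by metis
    then have "b\<^sup>2 * (j + 2) \<le> 4 ^ j"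
      by (simp add: power_mult_distrib mult.assoc)
    moreover have "b\<^sup>2 * (j + 1) \<le> b\<^sup>2 * (j + 2)"
      by (intro mult_left_mono) auto
    ultimately show ?thesis
      using le unfolding b_def by linarith
  qed
qed

lemma binomial_upper_sqrt: "real (j choose i) \<le> 2 ^ j / sqrt (real (j + 1))"
proof -
  have "real ((j choose i)\<^sup>2 * (j + 1)) \<le> real (4 ^ j)"
    using binomial_upper by (rule of_nat_mono)
  moreover have "real (4 ^ j) = (2 ^ j)\<^sup>2"
    by (simp add: power2_eq_square flip: power_mult_distrib)
  moreover have "(real (j choose i) * sqrt (real (j + 1)))\<^sup>2 = real ((j choose i)\<^sup>2 * (j + 1))"
    by (simp add: power_mult_distrib algebra_simps)
  ultimately have "(real (j choose i) * sqrt (real (j + 1)))\<^sup>2 \<le> (2 ^ j)\<^sup>2"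
    by simp
  then have "real (j choose i) * sqrt (real (j + 1)) \<le> 2 ^ j"
    by (rule power2_le_imp_le) simp
  then show ?thesis
    by (simp add: field_simps)
qed

text \<open>
  Conditioning on the positions of the entries \<open>\<ge> 2\<close> makes the weight a fair binomial variable
  on the remaining \<open>n - l\<close> coordinates; \<open>1 / sqrt (n - l + 1)\<close> is then averaged by AM-GM.
\<close>

lemma layer_size_bound:
  assumes "n \<ge> 1" "m \<ge> 1"
  shows "real ((n choose k) * m ^ k) \<le> real (m + 1) ^ (n + 1) / sqrt (real n)"
proof (cases "k \<le> n")
  case False
  then show ?thesis by (simp add: binomial_eq_0)
next
  case k: True
  \<comment> \<open>\<open>p\<close> counts the values \<open>\<ge> 2\<close> of an entry; the
    remaining nonzero value is 1.\<close>
  define p where "p = real m - 1"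
  have p: "p \<ge> 0" "real m = p + 1"
    using assms by (auto simp: p_def)
  \<comment> \<open>\<open>u l\<close> counts the vertices with exactly \<open>l\<close> entries
    \<open>\<ge> 2\<close>; the other \<open>n - l\<close> entries are 0 or 1.\<close>
  define u where "u l = real (n choose l) * p ^ l * 2 ^ (n - l)" for l
  have u0: "u l \<ge> 0" for l
    using p by (simp add: u_def)
  have sum_u: "(\<Sum>l\<le>n. u l) = real (m + 1) ^ n"
    using binomial_ring[of p 2 n] p by (simp add: u_def add.commute)
  \<comment> \<open>Dividing by \<open>n - l + 1\<close> absorbs into the binomial coefficient and
    raises \<open>n\<close> to \<open>n + 1\<close>, so the average of
    \<open>1 / (n - l + 1)\<close> comes from a second binomial sum.\<close>
  have quot: "u l / real (n - l + 1) =
      real ((n + 1) choose l) * p ^ l * 2 ^ (n + 1 - l) / (2 * real (n + 1))" if "l \<le> n" for l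
  proof -
    have "(n + 1 - l) * ((n + 1) choose l) = (n + 1) * (n choose l)"
      using binomial_absorb_comp[of "n + 1" l] by simp
    then have "real (n + 1 - l) * real ((n + 1) choose l) = real (n + 1) * real (n choose l)"
      by (metis of_nat_mult)
    then have "real (n choose l) / real (n + 1 - l) = real ((n + 1) choose l) / real (n + 1)"
      using that by (simp add: field_simps)
    moreover have "n - l + 1 = n + 1 - l"
      using that by simp
    ultimately have "u l / real (n - l + 1) =
        real ((n + 1) choose l) / real (n + 1) * p ^ l * 2 ^ (n - l)"
      unfolding u_def by (metis (no_types, lifting) times_divide_eq_left)
    then show ?thesis
      using that by (simp add: Suc_diff_le field_simps)
  qed
  have sum_quot: "(\<Sum>l\<le>n. u l / real (n - l + 1)) \<le> real (m + 1) ^ (n + 1) / (2 * real n)"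
  proof -
    have "(\<Sum>l\<le>n. u l / real (n - l + 1)) =
        (\<Sum>l\<le>n. real ((n + 1) choose l) * p ^ l * 2 ^ (n + 1 - l)) / (2 * real (n + 1))"
      by (simp only: sum_divide_distrib) (intro sum.cong refl quot, simp)
    also have "\<dots> \<le> (\<Sum>l\<le>n + 1. real ((n + 1) choose l) * p ^ l * 2 ^ (n + 1 - l)) / (2 * real (n + 1))"
      using p by (intro divide_right_mono sum_mono2) auto
    also have "\<dots> = real (m + 1) ^ (n + 1) / (2 * real (n + 1))"
      using binomial_ring[of p 2 "n + 1"] p by (simp add: add.commute)
    also have "\<dots> \<le> real (m + 1) ^ (n + 1) / (2 * real n)"
      using assms by (intro divide_left_mono) auto
    finally show ?thesis .
  qed
  have sqrt_sq: "sqrt (real n) * (sqrt (real n) * z) = real n * z" for z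
    by (simp flip: mult.assoc)
  have "real ((n choose k) * m ^ k) = real (n choose k) * (p + 1) ^ k"
    using p by simp
  also have "\<dots> = (\<Sum>l\<le>k. real (n choose k) * (real (k choose l) * p ^ l))"
    using binomial_ring[of p 1 k] by (simp add: sum_distrib_left)
  \<comment> \<open>Double counting: the \<open>l\<close> positions of entries
    \<open>\<ge> 2\<close> are chosen first, then the \<open>k - l\<close> positions of the ones
    among the rest.\<close>
  also have "\<dots> = (\<Sum>l\<le>k. real (n choose l) * p ^ l * real ((n - l) choose (k - l)))"
  proof (intro sum.cong refl)
    fix l assume "l \<in> {..k}"
    then have "(n choose k) * (k choose l) = (n choose l) * ((n - l) choose (k - l))"
      using k by (intro choose_mult) auto
    then have "real (n choose k) * real (k choose l) = real (n choose l) * real ((n - l) choose (k - l))"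
      by (metis of_nat_mult)
    then show "real (n choose k) * (real (k choose l) * p ^ l) =
        real (n choose l) * p ^ l * real ((n - l) choose (k - l))"
      by (simp add: algebra_simps)
  qed
  also have "\<dots> \<le> (\<Sum>l\<le>k. real (n choose l) * p ^ l * (2 ^ (n - l) / sqrt (real (n - l + 1))))"
    using p by (intro sum_mono mult_left_mono binomial_upper_sqrt) auto
  also have "\<dots> = (\<Sum>l\<le>k. u l * (1 / sqrt (real (n - l + 1))))"
    by (simp add: u_def)
  also have "\<dots> \<le> (\<Sum>l\<le>n. u l * (1 / sqrt (real (n - l + 1))))"
    using k u0 by (intro sum_mono2) auto
  \<comment> \<open>AM-GM, scaled by \<open>sqrt (real n)\<close> so that after averaging both terms
    have order \<open>1 / sqrt (real n)\<close>.\<close>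
  also have "\<dots> \<le> (\<Sum>l\<le>n. u l * ((sqrt (real n) / real (n - l + 1) + 1 / sqrt (real n)) / 2))"
  proof (intro sum_mono mult_left_mono u0)
    fix l
    define s where "s = sqrt (real (n - l + 1))"
    define t where "t = sqrt (real n)"
    have st: "s > 0" "t > 0" "s\<^sup>2 = real (n - l + 1)"
      using assms by (auto simp: s_def t_def)
    have "(s - t)\<^sup>2 \<ge> 0" by simp
    then have "1 / s \<le> (t / s\<^sup>2 + 1 / t) / 2"
      using st(1,2) by (simp add: field_simps power2_eq_square)
    then show "1 / sqrt (real (n - l + 1)) \<le> (sqrt (real n) / real (n - l + 1) + 1 / sqrt (real n)) / 2"
      using st(3) by (simp add: s_def t_def)
  qed
  also have "\<dots> = sqrt (real n) / 2 * (\<Sum>l\<le>n. u l / real (n - l + 1)) + (\<Sum>l\<le>n. u l) / (2 * sqrt (real n))"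
    by (simp add: sum_distrib_left sum_divide_distrib add_divide_distrib distrib_left sum.distrib mult_ac)
  also have "\<dots> \<le> sqrt (real n) / 2 * (real (m + 1) ^ (n + 1) / (2 * real n)) +
      real (m + 1) ^ n / (2 * sqrt (real n))"
    unfolding sum_u by (intro add_mono mult_left_mono sum_quot) auto
  also have "\<dots> = real (m + 1) ^ n / sqrt (real n) * (real (m + 1) / 4 + 1 / 2)"
    using assms(1) by (simp add: field_simps sqrt_sq)
  also have "\<dots> \<le> real (m + 1) ^ n / sqrt (real n) * real (m + 1)"
    by (intro mult_left_mono) (simp_all add: field_simps)
  finally show ?thesis
    by (simp add: mult.commute)
qed

section \<open>Assembling the bound on the lazy cop number\<close>

theorem theorem1p1:
  fixes m :: nat
  assumes "m \<ge> 2"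
  shows "\<exists>C > 0. \<exists>N. \<forall>n \<ge> N.
           real (lazy_cop_number (gen_hypercube n m)) \<le> C * real (m + 1) ^ n / real n powr (3 / 2)"
proof -
  have "real (lazy_cop_number (gen_hypercube n m)) \<le>
      (12 * real (m + 1)) * real (m + 1) ^ n / real n powr (3 / 2)" if n: "n \<ge> 1" for n
  proof -
    let ?G = "gen_hypercube n m"
    define M where "M = real (m + 1) ^ (n + 1) / sqrt (real n)"
    have M: "real ((n choose k) * m ^ k) \<le> M" for k
      unfolding M_def using assms n by (intro layer_size_bound) auto
    have M0: "M \<ge> 0"
      by (simp add: M_def)
    \<comment> \<open>The largest power of two not exceeding \<open>n\<close>. Since
      \<open>n < 2 ^ (r + 1)\<close>, replacing \<open>2 ^ r\<close> by \<open>n\<close> costs a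
      factor 2 and turns \<open>3 * M\<close> into \<open>6 * M\<close>.\<close>
    obtain r where r: "2 ^ r \<le> n" "n < 2 ^ (r + 1)"
      using ex_power_ivl1[of 2 n] n by auto
    \<comment> \<open>The size of one half of the cops. The two halves give
      \<open>12 * M / n\<close>, and the extra factor \<open>m + 1\<close> in \<open>M\<close> goes
      into the constant.\<close>
    define d where "d = nat \<lfloor>6 * M / real n\<rfloor>"
    have "\<forall>k. \<exists>D. D \<subseteq> pverts ?G \<and> 2 ^ r * real (card D) \<le> 3 * M \<and>
        (\<forall>x \<in> pverts ?G. weight n x = k \<longrightarrow> (\<exists>u \<in> D. (u, x) \<in> parcs ?G))"
      using layer_dominating_set[OF _ r(1) M] assms by simp
    then obtain D where D: "\<And>k. D k \<subseteq> pverts ?G" "\<And>k. 2 ^ r * real (card (D k)) \<le> 3 * M"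
      and dom: "\<And>k x. x \<in> pverts ?G \<Longrightarrow> weight n x = k \<Longrightarrow> \<exists>u \<in> D k. (u, x) \<in> parcs ?G"
      by metis
    have card_D: "card (D k) \<le> d" for k
    proof -
      have "real n \<le> 2 ^ (r + 1)"
        using of_nat_mono[OF less_imp_le[OF r(2)], where ?'a = real] by simp
      then have "real n * real (card (D k)) \<le> 2 ^ (r + 1) * real (card (D k))"
        by (rule mult_right_mono) simp
      also have "\<dots> \<le> 6 * M"
        using D(2)[of k] by (simp add: mult.commute)
      finally have "real (card (D k)) \<le> 6 * M / real n"
        using n by (simp add: field_simps)
      then show ?thesis
        unfolding d_def by linarith
    qed
    have "lazy_cops_win ?G (2 * d)"
    proof (rule lazy_cops_win_of_layer_dominating_sets[where w = "weight n" and D = D])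
      show "finite (pverts ?G)"
        by (simp add: pverts_gen_hypercube finite_PiE)
      show "pverts ?G \<noteq> {}"
        by (simp add: pverts_gen_hypercube PiE_eq_empty_iff)
      show "parcs ?G \<subseteq> pverts ?G \<times> pverts ?G"
        by (auto simp: gen_hypercube_def)
      show "\<exists>u \<in> D (weight n x). u = x \<or> (u, x) \<in> parcs ?G" if "x \<in> pverts ?G" for x
        using dom[OF that] by blast
    qed (rule gen_hypercube_connected weight_arc D(1) card_D; assumption?)+
    then have "lazy_cop_number ?G \<le> 2 * d"
      unfolding lazy_cop_number_def by (rule Least_le)
    then have "real (lazy_cop_number ?G) \<le> 2 * real d"
      by linarith
    also have "real d \<le> 6 * M / real n"
      using M0 by (simp add: d_def)
    also have "2 * (6 * M / real n) = (12 * real (m + 1)) * real (m + 1) ^ n / (real n * sqrt (real n))"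
      by (simp add: M_def field_simps)
    also have "real n * sqrt (real n) = real n powr (3 / 2)"
      using n powr_add[of "real n" 1 "1 / 2"] by (simp add: powr_half_sqrt)
    finally show ?thesis
      by simp
  qed
  then show ?thesis
    by (intro exI[of _ "12 * real (m + 1)"] conjI exI[of _ 1]) auto
qed

end
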